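(* Let $D\ge 1$ be an integer, let $X=\{0,1,\ldots,2D+1\}$ be equipped with the metric $d(x,y)=|x-y|$, and let $S=\{1,3,\ldots,2D+1\}\subset X$ be the set of odd elements of $X$. Then there exists an ultrametric on $S$ that $D$-approximates $d$ on $S$, while every ultrametric $\bar\rho$ on $X$ that $A$-approximates $d$ on pairs from $S\times X$, for some real $A$, satisfies $A\ge 2D+1$. In particular, for every integer $D\ge 1$, the following bound is tight: whenever $(X,d)$ is a locally compact metric space, $S\subset X$ is closed, and $\rho$ is an ultrametric on $S$ that $D$-approximates $d$ on $S$, there is an ultrametric on $X$ that $(2D+1)$-approximates $d$ on pairs from $S\times X$; here the factor $2D+1$ cannot be replaced by any smaller number.
   Context: An ultrametric on a set $X$ is a metric $\rho:X\times X\to[0,\infty)$ satisfying $\rho(x,z)\le\max\{\rho(x,y),\rho(y,z)\}$ for all $x,y,z\in X$. An ultrametric $\rho$ on $S$ $D$-approximates $d$ on $S$ if there exists $c>0$ such that $d(x,y)\le c\cdot\rho(x,y)\le D\cdot d(x,y)$ for all $x,y\in S$. An ultrametric $\bar\rho$ on $X$ $A$-approximates $d$ on pairs from $S\times X$ if there exists $c>0$ such that $d(x,y)\le c\cdot\bar\rho(x,y)\le A\cdot d(x,y)$ for all $x\in S$ and $y\in X$. *)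

theory Defs
  imports "HOL-Analysis.Analysis"
begin

(* Metric_space constrains the distance outside X only by nonnegativity and symmetry;
   every metric given on X alone extends to such a function. *)
definition ultrametric_on :: "'a set \<Rightarrow> ('a \<Rightarrow> 'a \<Rightarrow> real) \<Rightarrow> bool" where
  "ultrametric_on X \<rho> \<longleftrightarrow> Metric_space X \<rho> \<and>
     (\<forall>x\<in>X. \<forall>y\<in>X. \<forall>z\<in>X. \<rho> x z \<le> max (\<rho> x y) (\<rho> y z))"

definition approximates_on_pairs ::
    "'a set \<Rightarrow> 'a set \<Rightarrow> real \<Rightarrow> ('a \<Rightarrow> 'a \<Rightarrow> real) \<Rightarrow> ('a \<Rightarrow> 'a \<Rightarrow> real) \<Rightarrow> bool" where
  "approximates_on_pairs S X A \<rho> d \<longleftrightarrow>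
     (\<exists>c>0. \<forall>x\<in>S. \<forall>y\<in>X. d x y \<le> c * \<rho> x y \<and> c * \<rho> x y \<le> A * d x y)"

definition approximates_on ::
    "'a set \<Rightarrow> real \<Rightarrow> ('a \<Rightarrow> 'a \<Rightarrow> real) \<Rightarrow> ('a \<Rightarrow> 'a \<Rightarrow> real) \<Rightarrow> bool" where
  "approximates_on S D \<rho> d \<longleftrightarrow>
     (\<exists>c>0. \<forall>x\<in>S. \<forall>y\<in>S. d x y \<le> c * \<rho> x y \<and> c * \<rho> x y \<le> D * d x y)"

(* B is an admissible factor in the extension theorem, for all metric spaces whose points
   have type 'a; the type argument makes it possible to vary the class of spaces. *)
definition extension_factor :: "'a itself \<Rightarrow> real \<Rightarrow> real \<Rightarrow> bool" where
  "extension_factor (_ :: 'a itself) D B \<longleftrightarrow>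
     (\<forall>(X :: 'a set) d S \<rho>.
        Metric_space X d \<and> locally_compact_space (Metric_space.mtopology X d) \<and>
        closedin (Metric_space.mtopology X d) S \<and>
        ultrametric_on S \<rho> \<and> approximates_on S D \<rho> d \<longrightarrow>
        (\<exists>\<rho>'. ultrametric_on X \<rho>' \<and> approximates_on_pairs S X B \<rho>' d))"

end

theory Submission
  imports Defs
begin

text \<open>
  The extension. Rescale \<open>\<rho>\<close> so that \<open>d \<le> \<rho> \<le> D d\<close> on \<open>S\<close>, and let every point of \<open>X\<close> jump
  to any point \<open>s\<close> of \<open>S\<close> at the price \<open>2D d(y,s)\<close>. The cost of a route from \<open>y\<close> to \<open>z\<close> through
  \<open>s, t \<in> S\<close> is the largest of the three prices \<open>2D d(y,s)\<close>, \<open>\<rho>(s,t)\<close>, \<open>2D d(t,z)\<close>, and the new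
  distance of \<open>y\<close> and \<open>z\<close> is the infimum of the costs of all routes. The price \<open>2D\<close> is exactly what makes
  this an ultrametric: two routes that meet in \<open>z\<close>, one leaving \<open>S\<close> at \<open>t\<close> and the other entering it
  at \<open>t'\<close>, can be short-cut, since
  \<open>\<rho>(t,t') \<le> D (d(t,z) + d(z,t')) \<le> max (2D d(t,z)) (2D d(z,t'))\<close>.
  For \<open>x \<in> S\<close> the route that stays at \<open>x\<close> and jumps to \<open>y\<close> costs \<open>2D d(x,y)\<close>, and conversely a route of
  cost \<open>m\<close> from \<open>x\<close> to \<open>y\<close> shows \<open>d(x,y) \<le> m + m/(2D)\<close>; the quotient of the two bounds is
  \<open>2D (1 + 1/(2D)) = 2D + 1\<close>. Taking an infimum over all routes, instead of routing through a nearest point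
  of \<open>S\<close>, avoids the question whether a nearest point exists.

  The sharpness. Of two consecutive integers one is odd, so every step of the chain \<open>0, 1, \<dots>, 2D+1\<close> has
  length at most \<open>A\<close> in the normalised \<open>\<rho>'\<close>; hence so has the pair \<open>0, 2D+1\<close>. As \<open>2D+1\<close> is odd, that
  length is at least \<open>2D+1\<close>. On the odd points the distances range from \<open>2\<close> to \<open>2D\<close>, so a constant
  ultrametric is a \<open>D\<close>-approximation. Since the finite space \<open>X\<close> is compact and discrete, it is one of the
  spaces that the extension theorem speaks of, and so it bounds the factor there.
\<close>

section \<open>Ultrametrics\<close>

lemma ultrametric_onI:
  assumes nonneg: "\<And>x y. 0 \<le> \<rho> x y" and sym: "\<And>x y. \<rho> x y = \<rho> y x"
    and zero: "\<And>x y. x \<in> X \<Longrightarrow> y \<in> X \<Longrightarrow> \<rho> x y = 0 \<longleftrightarrow> x = y"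
    and ultra: "\<And>x y z. x \<in> X \<Longrightarrow> y \<in> X \<Longrightarrow> z \<in> X \<Longrightarrow> \<rho> x z \<le> max (\<rho> x y) (\<rho> y z)"
  shows "ultrametric_on X \<rho>"
proof -
  have "Metric_space X \<rho>"
  proof
    fix x y z assume "x \<in> X" "y \<in> X" "z \<in> X"
    then show "\<rho> x z \<le> \<rho> x y + \<rho> y z"
      using ultra[of x y z] nonneg[of x y] nonneg[of y z] by linarith
  qed (use nonneg sym zero in auto)
  then show ?thesis
    using ultra by (auto simp: ultrametric_on_def)
qed

lemma ultrametric_on_scale:
  assumes "ultrametric_on X \<rho>" and "c > 0"
  shows "ultrametric_on X (\<lambda>x y. c * \<rho> x y)"
proof -
  interpret Metric_space X \<rho>
    using assms by (simp add: ultrametric_on_def)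
  show ?thesis
  proof (rule ultrametric_onI)
    fix x y z assume "x \<in> X" "y \<in> X" "z \<in> X"
    then have "\<rho> x z \<le> max (\<rho> x y) (\<rho> y z)"
      using assms(1) by (auto simp: ultrametric_on_def)
    then show "c * \<rho> x z \<le> max (c * \<rho> x y) (c * \<rho> y z)"
      using \<open>c > 0\<close> by (auto simp: le_max_iff_disj)
  qed (use \<open>c > 0\<close> commute in auto)
qed

lemma ultrametric_on_discrete: "ultrametric_on X (\<lambda>x y. if x = y then 0 else 1)"
  by (rule ultrametric_onI) auto

lemma ultrametric_on_chain_le:
  assumes ultra: "ultrametric_on {0..n} \<rho>"
    and step: "\<And>i. i < n \<Longrightarrow> \<rho> i (Suc i) \<le> M"
    and "k < n"
  shows "\<rho> 0 (Suc k) \<le> M"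
  using \<open>k < n\<close>
proof (induction k)
  case 0
  then show ?case using step by simp
next
  case (Suc k)
  then have "\<rho> 0 (Suc (Suc k)) \<le> max (\<rho> 0 (Suc k)) (\<rho> (Suc k) (Suc (Suc k)))"
    using ultra by (auto simp: ultrametric_on_def)
  then show ?case
    using Suc step[of "Suc k"] by simp
qed

section \<open>Extending an ultrametric from a subset\<close>

definition route_cost ::
    "real \<Rightarrow> ('a \<Rightarrow> 'a \<Rightarrow> real) \<Rightarrow> ('a \<Rightarrow> 'a \<Rightarrow> real) \<Rightarrow> 'a \<Rightarrow> 'a \<Rightarrow> 'a \<times> 'a \<Rightarrow> real" where
  "route_cost K d \<rho> y z = (\<lambda>(s, t). max (K * d y s) (max (\<rho> s t) (K * d t z)))"

definition route_dist ::
    "'a set \<Rightarrow> real \<Rightarrow> ('a \<Rightarrow> 'a \<Rightarrow> real) \<Rightarrow> ('a \<Rightarrow> 'a \<Rightarrow> real) \<Rightarrow> 'a \<Rightarrow> 'a \<Rightarrow> real" where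
  "route_dist S K d \<rho> y z = (if y = z then 0 else Inf (route_cost K d \<rho> y z ` (S \<times> S)))"

text \<open>
  The normalised situation: the constant in the definition of approximation is absorbed into \<open>\<rho>\<close>, so
  that \<open>d\<close> and \<open>\<rho>\<close> can be compared, and hence combined in one maximum, directly.
\<close>

locale approximating_ultrametric =
  X: Metric_space X d for X :: "'a set" and d +
  fixes S :: "'a set" and \<rho> :: "'a \<Rightarrow> 'a \<Rightarrow> real" and D :: real
  assumes subset: "S \<subseteq> X" and nonempty: "S \<noteq> {}" and D_pos: "D > 0"
    and ultrametric: "ultrametric_on S \<rho>"
    and lower: "\<And>x y. x \<in> S \<Longrightarrow> y \<in> S \<Longrightarrow> d x y \<le> \<rho> x y"
    and upper: "\<And>x y. x \<in> S \<Longrightarrow> y \<in> S \<Longrightarrow> \<rho> x y \<le> D * d x y"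
begin

sublocale S: Metric_space S \<rho>
  using ultrametric by (simp add: ultrametric_on_def)

abbreviation cost where "cost \<equiv> route_cost (2 * D) d \<rho>"
abbreviation dist' where "dist' \<equiv> route_dist S (2 * D) d \<rho>"

lemma ultra: "x \<in> S \<Longrightarrow> y \<in> S \<Longrightarrow> z \<in> S \<Longrightarrow> \<rho> x z \<le> max (\<rho> x y) (\<rho> y z)"
  using ultrametric by (simp add: ultrametric_on_def)

lemma cost_nonneg: "0 \<le> cost y z p"
  by (auto simp: route_cost_def le_max_iff_disj split: prod.split)

lemma dist'_nonneg: "0 \<le> dist' y z"
  using nonempty by (auto simp: route_dist_def intro!: cINF_greatest cost_nonneg)

lemma dist'_le_cost: "s \<in> S \<Longrightarrow> t \<in> S \<Longrightarrow> dist' y z \<le> cost y z (s, t)"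
  using cost_nonneg by (auto simp: route_dist_def intro!: cINF_lower bdd_belowI2[where m = 0])

lemma cheap_routeE:
  assumes "dist' y z < m" and "y \<noteq> z"
  obtains s t where "s \<in> S" "t \<in> S" "cost y z (s, t) < m"
proof -
  have "bdd_below (cost y z ` (S \<times> S))"
    using cost_nonneg by (rule bdd_belowI2)
  then show ?thesis
    using assms nonempty that by (auto simp: route_dist_def cINF_less_iff)
qed

lemma dist'_greatest:
  assumes "y \<noteq> z" and "\<And>s t. s \<in> S \<Longrightarrow> t \<in> S \<Longrightarrow> m \<le> cost y z (s, t)"
  shows "m \<le> dist' y z"
  using assms nonempty by (auto simp: route_dist_def intro!: cINF_greatest)

lemma cost_flip: "cost y z (s, t) = cost z y (t, s)"
  by (simp add: route_cost_def X.commute S.commute max.commute max.left_commute)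

lemma dist'_commute: "dist' y z = dist' z y"
proof -
  have "dist' y z \<le> dist' z y" if "y \<noteq> z" for y z
    using that by (intro dist'_greatest) (auto simp: cost_flip[of z] intro: dist'_le_cost)
  from this[of y z] this[of z y] show ?thesis
    by (cases "y = z") auto
qed

text \<open>The price \<open>2D\<close> of a jump dominates a detour through a point outside \<open>S\<close>.\<close>

lemma shortcut:
  assumes "s \<in> S" "t \<in> S" "z \<in> X"
  shows "\<rho> s t \<le> max (2 * D * d s z) (2 * D * d z t)"
proof -
  have "\<rho> s t \<le> D * d s t"
    using assms upper by simp
  also have "\<dots> \<le> D * (d s z + d z t)"
    using assms subset D_pos by (intro mult_left_mono X.triangle) auto
  also have "\<dots> \<le> max (2 * D * d s z) (2 * D * d z t)"
    by (simp add: algebra_simps)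
  finally show ?thesis .
qed

lemma dist'_ultra:
  assumes X: "x \<in> X" "y \<in> X" "z \<in> X"
  shows "dist' x z \<le> max (dist' x y) (dist' y z)"
proof (cases "x = y \<or> y = z")
  case True
  then show ?thesis by (auto simp: le_max_iff_disj)
next
  case False
  show ?thesis
  proof (rule dense_ge)
    fix m assume m: "max (dist' x y) (dist' y z) < m"
    obtain s t where st: "s \<in> S" "t \<in> S" "cost x y (s, t) < m"
      using m False by (auto elim: cheap_routeE)
    obtain u v where uv: "u \<in> S" "v \<in> S" "cost y z (u, v) < m"
      using m False by (auto elim: cheap_routeE)
    have "\<rho> t u < m"
      using shortcut[of t u y] st uv X by (auto simp: route_cost_def)
    then have "\<rho> s v < m"
      using ultra[of s t v] ultra[of t u v] st uv by (auto simp: route_cost_def)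
    then have "cost x z (s, v) < m"
      using st uv by (auto simp: route_cost_def)
    then show "dist' x z \<le> m"
      using dist'_le_cost[of s v x z] st uv by simp
  qed
qed

text \<open>
  This bound keeps distinct points of \<open>X\<close> apart: although \<open>dist'\<close> is an infimum, it cannot vanish on
  them, because no route is much cheaper than \<open>d\<close>.
\<close>

lemma le_cost:
  assumes "y \<in> X" "z \<in> X" "s \<in> S" "t \<in> S"
  shows "D * d y z \<le> (D + 1) * cost y z (s, t)"
proof -
  let ?m = "cost y z (s, t)"
  have "d y z \<le> d y s + d s t + d t z"
    using X.triangle[of y s z] X.triangle[of s t z] assms subset by force
  then have "D * d y z \<le> D * (d y s + d s t + d t z)"
    using D_pos by simp
  moreover have "2 * D * d y s \<le> ?m" "2 * D * d t z \<le> ?m"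
    by (auto simp: route_cost_def)
  moreover have "D * d s t \<le> D * ?m"
    using lower[of s t] assms D_pos by (auto simp: route_cost_def le_max_iff_disj)
  ultimately show ?thesis
    by (simp add: algebra_simps)
qed

lemma ultrametric_on_dist': "ultrametric_on X dist'"
proof (rule ultrametric_onI[OF dist'_nonneg dist'_commute _ dist'_ultra])
  fix y z assume yz: "y \<in> X" "z \<in> X"
  have "0 < dist' y z" if "y \<noteq> z"
  proof -
    have "D * d y z / (D + 1) \<le> dist' y z"
      using that le_cost[OF yz] D_pos
      by (intro dist'_greatest) (auto simp: divide_le_eq mult.commute)
    moreover have "0 < D * d y z / (D + 1)"
      using that yz D_pos by simp
    ultimately show ?thesis by linarith
  qed
  then show "dist' y z = 0 \<longleftrightarrow> y = z"
    by (auto simp: route_dist_def)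
qed

text \<open>
  When the first end \<open>x\<close> of the route lies in \<open>S\<close>, its first jump can be absorbed into \<open>\<rho>\<close>, so that
  only the last jump contributes an error; this improves \<open>1 + 1/D\<close> to \<open>1 + 1/(2D)\<close>.
\<close>

lemma le_cost_of_mem:
  assumes "x \<in> S" "y \<in> X" "s \<in> S" "t \<in> S"
  shows "2 * D * d x y \<le> (2 * D + 1) * cost x y (s, t)"
proof -
  let ?m = "cost x y (s, t)"
  have "\<rho> x s \<le> ?m"
    using shortcut[of x s s] assms subset D_pos
    by (auto simp: route_cost_def le_max_iff_disj)
  then have "\<rho> x t \<le> ?m"
    using ultra[of x s t] assms by (auto simp: route_cost_def le_max_iff_disj)
  then have "2 * D * d x t \<le> 2 * D * ?m"
    using lower[of x t] assms D_pos by auto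
  moreover have "2 * D * d x y \<le> 2 * D * (d x t + d t y)"
    using X.triangle[of x t y] assms subset D_pos by auto
  moreover have "2 * D * d t y \<le> ?m"
    by (auto simp: route_cost_def)
  ultimately show ?thesis
    by (simp add: algebra_simps)
qed

lemma approximates_dist': "approximates_on_pairs S X (2 * D + 1) dist' d"
proof -
  \<comment> \<open>The distance is between \<open>2D/(2D+1)\<close> times and \<open>2D\<close> times \<open>d\<close>; this \<open>c\<close> makes the lower factor 1.\<close>
  define c where "c = (2 * D + 1) / (2 * D)"
  have "c > 0"
    using D_pos by (simp add: c_def)
  have "d x y \<le> c * dist' x y \<and> c * dist' x y \<le> (2 * D + 1) * d x y"
    if xy: "x \<in> S" "y \<in> X" for x y
  proof (cases "x = y")
    case True
    then show ?thesis
      using xy by (simp add: route_dist_def)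
  next
    case False
    have "2 * D * d x y / (2 * D + 1) \<le> dist' x y"
      using False le_cost_of_mem[OF xy] D_pos
      by (intro dist'_greatest) (auto simp: divide_le_eq mult.commute)
    moreover have "cost x y (x, x) = 2 * D * d x y"
      using xy subset D_pos by (auto simp: route_cost_def)
    then have "dist' x y \<le> 2 * D * d x y"
      using dist'_le_cost[of x x x y] xy by simp
    moreover have "c * (2 * D * d x y) = (2 * D + 1) * d x y"
      using D_pos by (simp add: c_def)
    moreover have "c * (2 * D * d x y / (2 * D + 1)) = d x y"
      using D_pos by (simp add: c_def)
    ultimately show ?thesis
      using mult_left_mono[of _ _ c] \<open>c > 0\<close> by (metis less_imp_le)
  qed
  with \<open>c > 0\<close> show ?thesis
    by (auto simp: approximates_on_pairs_def)
qed

end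

lemma extension_factor_2D_plus_1:
  assumes "D > 0"
  shows "extension_factor TYPE('a) D (2 * D + 1)"
  unfolding extension_factor_def
proof (intro allI impI, elim conjE)
  fix X :: "'a set" and d S \<rho>
  assume d: "Metric_space X d" and S: "closedin (Metric_space.mtopology X d) S"
    and \<rho>: "ultrametric_on S \<rho>" "approximates_on S D \<rho> d"
  show "\<exists>\<rho>'. ultrametric_on X \<rho>' \<and> approximates_on_pairs S X (2 * D + 1) \<rho>' d"
  proof (cases "S = {}")
    case True
    then show ?thesis
      using ultrametric_on_discrete
      by (intro exI conjI) (auto simp: approximates_on_pairs_def intro!: exI[of _ "1::real"])
  next
    case False
    obtain c where c: "c > 0"
      "\<And>x y. x \<in> S \<Longrightarrow> y \<in> S \<Longrightarrow> d x y \<le> c * \<rho> x y \<and> c * \<rho> x y \<le> D * d x y"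
      using \<rho>(2) by (auto simp: approximates_on_def)
    have "S \<subseteq> X"
      using closedin_subset[OF S] Metric_space.topspace_mtopology[OF d] by simp
    then interpret approximating_ultrametric X d S "\<lambda>x y. c * \<rho> x y" D
      using d False assms c ultrametric_on_scale[OF \<rho>(1) c(1)]
      by (simp add: approximating_ultrametric_def approximating_ultrametric_axioms_def)
    show ?thesis
      using ultrametric_on_dist' approximates_dist' by blast
  qed
qed

section \<open>Sharpness\<close>

lemma approximates_on_odd:
  assumes "D \<ge> 1"
  shows "approximates_on {x \<in> {0..2 * D + 1}. odd x} (real D)
    (\<lambda>x y. if x = y then 0 else 1) (\<lambda>x y. \<bar>real x - real y\<bar>)"
  unfolding approximates_on_def
proof (intro exI[of _ "2 * real D"] conjI ballI)
  fix x y assume xy: "x \<in> {x \<in> {0..2 * D + 1}. odd x}" "y \<in> {x \<in> {0..2 * D + 1}. odd x}"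
  have "1 \<le> x" "1 \<le> y"
    using xy by (auto simp: Suc_le_eq intro: odd_pos)
  then show "\<bar>real x - real y\<bar> \<le> 2 * real D * (if x = y then 0 else 1)"
    using xy by auto
  have "2 \<le> \<bar>real x - real y\<bar>" if "x \<noteq> y"
  proof -
    have "even (int x - int y)" "int x - int y \<noteq> 0"
      using xy that by auto
    then have "2 \<le> \<bar>int x - int y\<bar>"
      by presburger
    then show ?thesis by linarith
  qed
  then have "x \<noteq> y \<Longrightarrow> real D * 2 \<le> real D * \<bar>real x - real y\<bar>"
    by (intro mult_left_mono) auto
  then show "2 * real D * (if x = y then 0 else 1) \<le> real D * \<bar>real x - real y\<bar>"
    by auto
qed (use assms in auto)

lemma approximation_factor_ge:
  assumes ultra: "ultrametric_on {0..2 * D + 1} \<rho>"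
    and approx: "approximates_on_pairs {x \<in> {0..2 * D + 1}. odd x} {0..2 * D + 1} A
      \<rho> (\<lambda>x y. \<bar>real x - real y\<bar>)"
  shows "A \<ge> 2 * real D + 1"
proof -
  obtain c where "c > 0" and c: "\<And>x y. x \<le> 2 * D + 1 \<Longrightarrow> odd x \<Longrightarrow> y \<le> 2 * D + 1 \<Longrightarrow>
      \<bar>real x - real y\<bar> \<le> c * \<rho> x y \<and> c * \<rho> x y \<le> A * \<bar>real x - real y\<bar>"
    using approx by (auto simp: approximates_on_pairs_def)
  define \<sigma> where "\<sigma> = (\<lambda>x y. c * \<rho> x y)"
  have \<sigma>: "ultrametric_on {0..2 * D + 1} \<sigma>"
    unfolding \<sigma>_def using ultra \<open>c > 0\<close> by (rule ultrametric_on_scale)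
  then have sym: "\<sigma> x y = \<sigma> y x" for x y
    using Metric_space.commute[of _ \<sigma> x y] unfolding ultrametric_on_def by blast
  have "\<sigma> i (Suc i) \<le> A" if "i < 2 * D + 1" for i
  proof (cases "odd i")
    case True
    then show ?thesis using c[of i "Suc i"] that by (simp add: \<sigma>_def)
  next
    case False
    then show ?thesis using c[of "Suc i" i] that sym[of i "Suc i"] by (auto simp: \<sigma>_def)
  qed
  then have "\<sigma> 0 (Suc (2 * D)) \<le> A"
    by (intro ultrametric_on_chain_le[OF \<sigma>]) auto
  moreover have "2 * real D + 1 \<le> \<sigma> (Suc (2 * D)) 0"
    using c[of "Suc (2 * D)" 0] by (simp add: \<sigma>_def)
  ultimately show ?thesis
    using sym[of 0 "Suc (2 * D)"] by linarith
qed

lemma (in Metric_space) finite_locally_compact_closedin: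
  assumes "finite M" and "S \<subseteq> M"
  shows "locally_compact_space mtopology" and "closedin mtopology S"
proof -
  show "locally_compact_space mtopology"
    using assms by (intro compact_imp_locally_compact_space)
      (simp add: compact_space_def finite_imp_compactin)
  show "closedin mtopology S"
    using assms by (intro closedin_Hausdorff_finite Hausdorff_space_mtopology)
      (auto intro: finite_subset)
qed

theorem mainTheorem2:
  fixes D :: nat and X S :: "nat set" and d :: "nat \<Rightarrow> nat \<Rightarrow> real"
  assumes "D \<ge> 1"
    and "X = {0..2 * D + 1}"
    and "d = (\<lambda>x y. \<bar>real x - real y\<bar>)"
    and "S = {x \<in> X. odd x}"
  shows "(\<exists>\<rho>. ultrametric_on S \<rho> \<and> approximates_on S (real D) \<rho> d)
    \<and> (\<forall>\<rho>' A. ultrametric_on X \<rho>' \<and> approximates_on_pairs S X A \<rho>' d \<longrightarrow> A \<ge> 2 * real D + 1)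
    \<and> extension_factor TYPE('a) (real D) (2 * real D + 1)
    \<and> (\<forall>B < 2 * real D + 1. \<not> extension_factor TYPE(nat) (real D) B)"
proof (intro conjI allI impI notI)
  show ex: "\<exists>\<rho>. ultrametric_on S \<rho> \<and> approximates_on S (real D) \<rho> d"
    using ultrametric_on_discrete approximates_on_odd[OF assms(1)] assms(2-4) by blast
  show ge: "A \<ge> 2 * real D + 1"
    if "ultrametric_on X \<rho>' \<and> approximates_on_pairs S X A \<rho>' d" for \<rho>' A
    using that approximation_factor_ge[of D \<rho>' A] assms(2-4) by simp
  show "extension_factor TYPE('a) (real D) (2 * real D + 1)"
    using assms(1) by (intro extension_factor_2D_plus_1) simp
  fix B assume B: "B < 2 * real D + 1" and ext: "extension_factor TYPE(nat) (real D) B"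
  interpret Metric_space X d
    by standard (auto simp: assms(3))
  have "finite X" "S \<subseteq> X"
    using assms(2,4) by auto
  then have "locally_compact_space mtopology" "closedin mtopology S"
    by (rule finite_locally_compact_closedin)+
  then obtain \<rho>' where "ultrametric_on X \<rho>' \<and> approximates_on_pairs S X B \<rho>' d"
    using ext ex Metric_space_axioms unfolding extension_factor_def by blast
  then show False
    using ge B by fastforce
qed

end
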